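(* There is an absolute constant $c$ such that the following holds. Let $k\ge 2$ and let $G=(V,E)$ be a $k$-quasi-planar (not necessarily simple) topological graph with $n$ vertices, whose edges are drawn as $x$-monotone curves. Then $|E(G)| \leq 2^{ck^6}\, n\log n$.
   Context: A topological graph is a graph drawn in the plane so that vertices are distinct points and edges are non-self-intersecting arcs joining the corresponding points; no edge passes through a vertex other than its endpoints, any two edges meet in finitely many points, and tangencies are not allowed (if two edges share an interior point they properly cross there). It is $k$-quasi-planar if no $k$ of its edges are pairwise crossing. An edge is drawn as an $x$-monotone curve if every vertical line meets it in at most one point. *)

theory Defs
  imports "HOL-Analysis.Analysis"
begin

type_synonym pt = "real \<times> real"

text \<open>An edge is an ordered pair (u,v) of vertices with x(u) < x(v); its drawing is the
  graph of the function g u v over the interval [x(u), x(v)] (an x-monotone curve).\<close>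

definition curve :: "(pt \<Rightarrow> pt \<Rightarrow> real \<Rightarrow> real) \<Rightarrow> pt \<times> pt \<Rightarrow> pt set" where
  "curve g e = (\<lambda>x. (x, g (fst e) (snd e) x)) ` {fst (fst e) .. fst (snd e)}"

definition interior_pts :: "(pt \<Rightarrow> pt \<Rightarrow> real \<Rightarrow> real) \<Rightarrow> pt \<times> pt \<Rightarrow> pt set" where
  "interior_pts g e = curve g e - {fst e, snd e}"

definition crosses_at :: "(pt \<Rightarrow> pt \<Rightarrow> real \<Rightarrow> real) \<Rightarrow> pt \<times> pt \<Rightarrow> pt \<times> pt \<Rightarrow> real \<Rightarrow> bool" where
  "crosses_at g e e' x0 \<longleftrightarrow> (\<exists>\<delta>>0. \<forall>x y. x0 - \<delta> < x \<and> x < x0 \<and> x0 < y \<and> y < x0 + \<delta> \<longrightarrow>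
     (g (fst e) (snd e) x - g (fst e') (snd e') x) * (g (fst e) (snd e) y - g (fst e') (snd e') y) < 0)"

definition xmono_topological_graph :: "pt set \<Rightarrow> (pt \<times> pt) set \<Rightarrow> (pt \<Rightarrow> pt \<Rightarrow> real \<Rightarrow> real) \<Rightarrow> bool" where
  "xmono_topological_graph V E g \<longleftrightarrow>
     finite V \<and> E \<subseteq> V \<times> V \<and>
     (\<forall>(u,v)\<in>E. fst u < fst v \<and> continuous_on {fst u .. fst v} (g u v)
                 \<and> g u v (fst u) = snd u \<and> g u v (fst v) = snd v) \<and>
     (\<forall>e\<in>E. \<forall>w\<in>V. w \<noteq> fst e \<and> w \<noteq> snd e \<longrightarrow> w \<notin> curve g e) \<and>
     (\<forall>e\<in>E. \<forall>e'\<in>E. e \<noteq> e' \<longrightarrow> finite (curve g e \<inter> curve g e')) \<and>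
     (\<forall>e\<in>E. \<forall>e'\<in>E. e \<noteq> e' \<longrightarrow>
        (\<forall>p \<in> interior_pts g e \<inter> interior_pts g e'. crosses_at g e e' (fst p)))"

definition edges_cross :: "(pt \<Rightarrow> pt \<Rightarrow> real \<Rightarrow> real) \<Rightarrow> pt \<times> pt \<Rightarrow> pt \<times> pt \<Rightarrow> bool" where
  "edges_cross g e e' \<longleftrightarrow> e \<noteq> e' \<and> interior_pts g e \<inter> interior_pts g e' \<noteq> {}"

definition quasi_planar :: "nat \<Rightarrow> (pt \<times> pt) set \<Rightarrow> (pt \<Rightarrow> pt \<Rightarrow> real \<Rightarrow> real) \<Rightarrow> bool" where
  "quasi_planar k E g \<longleftrightarrow>
     \<not> (\<exists>F \<subseteq> E. card F = k \<and> (\<forall>e\<in>F. \<forall>e'\<in>F. e \<noteq> e' \<longrightarrow> edges_cross g e e'))"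

end

theory Submission
  imports Defs
begin

text \<open>Cut by a vertical line \<open>L\<close>. The edges crossing \<open>L\<close>, sorted by height on \<open>L\<close>, are divided into
  blocks of \<open>D\<^sup>2\<close> consecutive edges; as no two edges share both endpoints, each block has at least
  \<open>D\<close> right endpoints or at least \<open>D\<close> left endpoints. The incidence matrix between endpoints on one
  side and blocks has only linearly many ones: otherwise, after thinning every star to pairwise
  disjoint arcs (which costs a factor \<open>k - 1\<close>), it contains \<open>(k - 1)\<^sup>2 + 1\<close> nested pairs of arcs whose
  apexes move away from \<open>L\<close> towards the inside. Of two nested pairs, either the lower arcs cross or the
  upper arcs cross. Among the lower arcs disjointness is a partial order, so by Dilworth either \<open>k\<close> of
  them pairwise cross, or \<open>k\<close> of them are pairwise disjoint and the corresponding upper arcs pairwise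
  cross. Hence, for \<open>D\<close> a large constant, there are \<open>O(n)\<close> blocks and \<open>O(n)\<close> edges crossing \<open>L\<close>,
  and divide and conquer at the median abscissa gives \<open>O(n log n)\<close> edges.\<close>

section \<open>Matrices without nested pairs\<close>

text \<open>Induction on the rows, removing the lowest row \<open>x\<close>. Every other row has at
  most one entry strictly inside the span of \<open>x\<close>, so the columns there can be merged
  without loss. The forbidden pattern includes ties \<open>r x = r y\<close>, because it is later
  applied to rows that were split into several rows with equal key.\<close>

lemma no_abba_card_le:
  fixes A :: "('r \<times> nat) set" and r :: "'r \<Rightarrow> real"
  assumes "finite R" "finite C" "A \<subseteq> R \<times> C"
    and "\<And>x y a b c d. \<lbrakk>(x, a) \<in> A; (y, b) \<in> A; (y, c) \<in> A; (x, d) \<in> A; x \<noteq> y; r x \<le> r y;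
            a < b; b < c; c < d\<rbrakk> \<Longrightarrow> False"
  shows "card A \<le> 3 * card R + card C"
  using assms
proof (induction "card R" arbitrary: R A C)
  case 0
  then have "A = {}" by auto
  then show ?case by simp
next
  case (Suc m)
  have finA: "finite A"
    using Suc.prems by (meson finite_SigmaI finite_subset)
  have "R \<noteq> {}" using Suc.hyps(2) by auto
  then obtain x where x: "x \<in> R" "\<And>y. y \<in> R \<Longrightarrow> r x \<le> r y"
    using Suc.prems(1) by (metis arg_min_if_finite(1) arg_min_least)
  define S where "S = {c. (x, c) \<in> A}"
  define B where "B = {p \<in> A. fst p \<noteq> x}"
  have SC: "S \<subseteq> C" using Suc.prems(3) by (auto simp: S_def)
  then have finS: "finite S" using Suc.prems(2) finite_subset by blast
  have "A = B \<union> Pair x ` S" by (auto simp: B_def S_def)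
  moreover have "B \<inter> Pair x ` S = {}" by (auto simp: B_def)
  moreover have "finite B" using finA by (auto simp: B_def)
  ultimately have cardA: "card A = card B + card S"
    using finS by (simp add: card_Un_disjoint card_image inj_on_def)
  have cR: "m = card (R - {x})" using Suc.hyps(2) x(1) Suc.prems(1) by simp
  show ?case
  proof (cases "card S \<le> 3")
    case True
    have "card B \<le> 3 * card (R - {x}) + card C"
    proof (rule Suc.hyps(1)[OF cR])
      show "B \<subseteq> (R - {x}) \<times> C" using Suc.prems(3) by (auto simp: B_def)
      fix x' y a b c d
      assume "(x', a) \<in> B" "(y, b) \<in> B" "(y, c) \<in> B" "(x', d) \<in> B" "x' \<noteq> y" "r x' \<le> r y"
        "a < b" "b < c" "c < d"
      then show False using Suc.prems(4)[of x' a y b c d] by (auto simp: B_def)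
    qed (use Suc.prems in auto)
    then show ?thesis using True cardA cR Suc.hyps(2) by simp
  next
    case False
    define lo hi where "lo = Min S" and "hi = Max S"
    define I where "I = {c \<in> C. lo < c \<and> c < hi}"
    have Sne: "S \<noteq> {}" using False by auto
    have lohi: "lo \<in> S" "hi \<in> S" using finS Sne by (auto simp: lo_def hi_def)
    have "S - {lo, hi} \<subseteq> I"
    proof
      fix c assume c: "c \<in> S - {lo, hi}"
      then have "lo \<le> c" "c \<le> hi" using finS by (auto simp: lo_def hi_def)
      then show "c \<in> I" using c SC by (auto simp: I_def)
    qed
    moreover have finI: "finite I" using Suc.prems(2) by (simp add: I_def)
    ultimately have "card (S - {lo, hi}) \<le> card I" by (simp add: card_mono)
    moreover have "card S \<le> card (S - {lo, hi}) + card {lo, hi}"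
      using diff_card_le_card_Diff[of "{lo,hi}" S] by simp
    moreover have "card {lo, hi} \<le> 2" by (simp add: card_insert_if)
    ultimately have cardI: "card S \<le> card I + 2" by linarith
    then have "I \<noteq> {}" using False by auto
    then obtain s where s: "s \<in> I" by auto
    \<comment> \<open>By \<open>inner\<close> below, contracting the columns strictly inside the span of the lowest row \<open>x\<close>
      to the single column \<open>s\<close> merges no two ones.\<close>
    define f where "f c = (if c \<in> I then s else c)" for c
    have f_less: "a < b" if "f a < f b" "a \<in> C" "b \<in> C" for a b
      using that s by (auto simp: f_def I_def split: if_splits)
    have inner: "c = c'" if "(y, c) \<in> B" "(y, c') \<in> B" "c \<in> I" "c' \<in> I" for y c c'
    proof (rule ccontr)
      assume ne: "c \<noteq> c'"
      have "x \<noteq> y" "r x \<le> r y" using that(1) Suc.prems(3) x(2) by (auto simp: B_def)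
      moreover have "(x, lo) \<in> A" "(x, hi) \<in> A" using lohi by (auto simp: S_def)
      ultimately show False
        using that ne Suc.prems(4)[of x lo y c c' hi] Suc.prems(4)[of x lo y c' c hi]
        by (cases "c < c'") (auto simp: B_def I_def)
    qed
    define B' where "B' = (\<lambda>(y, c). (y, f c)) ` B"
    have "inj_on (\<lambda>(y, c). (y, f c)) B"
    proof (rule inj_onI)
      fix p q
      assume *: "p \<in> B" "q \<in> B" "(case p of (y, c) \<Rightarrow> (y, f c)) = (case q of (y, c) \<Rightarrow> (y, f c))"
      then show "p = q"
        using s inner[of "fst p" "snd p" "snd q"]
        by (cases p; cases q) (auto simp: f_def split: if_splits)
    qed
    then have cB: "card B' = card B" by (simp add: B'_def card_image)
    define C' where "C' = insert s (C - I)"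
    have fC: "f c \<in> C'" if "c \<in> C" for c using that by (simp add: f_def C'_def)
    have "card B' \<le> 3 * card (R - {x}) + card C'"
    proof (rule Suc.hyps(1)[OF cR])
      show "finite (R - {x})" "finite C'" using Suc.prems by (auto simp: C'_def)
      show "B' \<subseteq> (R - {x}) \<times> C'"
        using Suc.prems(3) fC by (auto simp: B'_def B_def)
      fix x' y a b c d
      assume *: "(x', a) \<in> B'" "(y, b) \<in> B'" "(y, c) \<in> B'" "(x', d) \<in> B'" "x' \<noteq> y" "r x' \<le> r y"
        "a < b" "b < c" "c < d"
      then obtain a0 b0 c0 d0 where
        0: "(x', a0) \<in> B" "(y, b0) \<in> B" "(y, c0) \<in> B" "(x', d0) \<in> B"
          "a = f a0" "b = f b0" "c = f c0" "d = f d0"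
        by (auto simp: B'_def)
      then have A0: "(x', a0) \<in> A" "(y, b0) \<in> A" "(y, c0) \<in> A" "(x', d0) \<in> A"
        by (auto simp: B_def)
      then have "a0 < b0" "b0 < c0" "c0 < d0"
        using f_less * 0(5-) Suc.prems(3) by auto
      then show False using Suc.prems(4)[OF A0] * by blast
    qed
    \<comment> \<open>Row \<open>x\<close> has at most \<open>card I + 2\<close> entries, while the
      contraction removes \<open>card I - 1\<close> columns; the balance of 3 is charged to
      \<open>x\<close>.\<close>
    moreover have "card C' \<le> Suc (card (C - I))" by (simp add: C'_def card_insert_le_m1 card_insert_if)
    moreover have "card (C - I) = card C - card I" "card I \<le> card C"
      using finI Suc.prems(2) by (auto simp: I_def intro: card_Diff_subset card_mono)
    ultimately show ?thesis using cB cardA cardI cR Suc.hyps(2) by linarith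
  qed
qed

text \<open>In the application a row is an apex keyed by its rank in distance from the line, a
  column is a block of heights on the line, and two entries of a row are two arcs with a common
  apex. Index 0 is the outermost pair.\<close>

definition nest :: "('r \<times> nat) set \<Rightarrow> ('r \<Rightarrow> real) \<Rightarrow> nat \<Rightarrow> (nat \<Rightarrow> 'r) \<Rightarrow> (nat \<Rightarrow> nat) \<Rightarrow> (nat \<Rightarrow> nat) \<Rightarrow> bool" where
  "nest A r l v a b \<longleftrightarrow>
     (\<forall>i<l. a i < b i \<and> (v i, a i) \<in> A \<and> (v i, b i) \<in> A) \<and>
     (\<forall>j<l. \<forall>i<j. r (v i) < r (v j) \<and> a i < a j \<and> b j < b i)"

lemma nest_extend:
  assumes n: "nest M r (Suc l) v a b" and "M \<subseteq> A"
    and w: "(w, c) \<in> A" "(w, d) \<in> A" "r (v l) < r w" "a l < c" "c < d" "d < b l"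
  shows "nest A r (Suc (Suc l)) (v(Suc l := w)) (a(Suc l := c)) (b(Suc l := d))"
proof -
  have "r (v i) < r w \<and> a i < c \<and> d < b i" if "i < Suc l" for i
  proof (cases "i = l")
    case False
    then have "i < l" using that by simp
    then have "r (v i) < r (v l) \<and> a i < a l \<and> b l < b i" using n by (simp add: nest_def)
    then show ?thesis using w by force
  qed (use w in auto)
  then show ?thesis using n w(1,2,5) \<open>M \<subseteq> A\<close> unfolding nest_def
    by (intro conjI allI impI) (auto elim!: less_SucE dest: spec)
qed

text \<open>Scan \<open>S\<close> from left to right. An element becomes a mark if there is none yet
  or if \<open>P\<close> holds from the last mark to it; \<open>f\<close> sends each element to the
  last mark so far. Monotonicity carries \<open>P\<close> from the last mark to all earlier
  ones.\<close>

lemma greedy_marks: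
  fixes S :: "nat set"
  assumes "finite S" and mono: "\<And>s s' e. P s e \<Longrightarrow> s' \<le> s \<Longrightarrow> P s' e" and irr: "\<And>e. \<not> P e e"
  obtains M f where "M \<subseteq> S" "\<And>e. e \<in> S \<Longrightarrow> f e \<in> M \<and> f e \<le> e \<and> \<not> P (f e) e"
    "\<And>e e'. e \<in> S \<Longrightarrow> e' \<in> S \<Longrightarrow> e \<le> e' \<Longrightarrow> f e \<le> f e'"
    "\<And>s s'. s \<in> M \<Longrightarrow> s' \<in> M \<Longrightarrow> s < s' \<Longrightarrow> P s s'"
  using assms(1)
proof (induction arbitrary: thesis rule: finite_linorder_max_induct)
  case empty
  then show ?case by (metis empty_iff subset_refl)
next
  case (insert b S)
  obtain M f where M: "M \<subseteq> S"
    and f: "\<And>e. e \<in> S \<Longrightarrow> f e \<in> M \<and> f e \<le> e \<and> \<not> P (f e) e"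
    and fm: "\<And>e e'. e \<in> S \<Longrightarrow> e' \<in> S \<Longrightarrow> e \<le> e' \<Longrightarrow> f e \<le> f e'"
    and p: "\<And>s s'. s \<in> M \<Longrightarrow> s' \<in> M \<Longrightarrow> s < s' \<Longrightarrow> P s s'"
    using insert.IH by blast
  have finM: "finite M" using M insert.hyps(1) finite_subset by blast
  have lt: "e < b" if "e \<in> S" for e using that insert.hyps(2) by blast
  have "b \<notin> S" using lt by blast
  show ?case
  proof (cases "M = {} \<or> P (Max M) b")
    case True
    have Pb: "P s b" if "s \<in> M" for s
      using True that mono[of "Max M" b s] finM by auto
    show ?thesis
    proof (rule insert.prems[of "insert b M" "f(b := b)"])
      show "(f(b := b)) e \<in> insert b M \<and> (f(b := b)) e \<le> e \<and> \<not> P ((f(b := b)) e) e"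
        if "e \<in> insert b S" for e
        using that f irr by auto
      show "(f(b := b)) e \<le> (f(b := b)) e'" if "e \<in> insert b S" "e' \<in> insert b S" "e \<le> e'" for e e'
      proof (cases "e' = b")
        case True
        then show ?thesis using f[of e] that by (cases "e = b") auto
      next
        case False
        then show ?thesis using that fm[of e e'] lt[of e'] by auto
      qed
      show "P s s'" if "s \<in> insert b M" "s' \<in> insert b M" "s < s'" for s s'
      proof (cases "s' = b")
        case True
        then show ?thesis using Pb that by auto
      next
        case False
        then show ?thesis using that p[of s s'] lt[of s'] M by auto
      qed
    qed (use M in auto)
  next
    case False
    then have mx: "Max M \<in> M" "\<And>s. s \<in> M \<Longrightarrow> s \<le> Max M" using finM by auto
    then have "Max M < b" using M lt by auto
    show ?thesis
    proof (rule insert.prems[of M "f(b := Max M)"])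
      show "(f(b := Max M)) e \<in> M \<and> (f(b := Max M)) e \<le> e \<and> \<not> P ((f(b := Max M)) e) e"
        if "e \<in> insert b S" for e
        using that f mx False \<open>Max M < b\<close> by auto
      show "(f(b := Max M)) e \<le> (f(b := Max M)) e'"
        if "e \<in> insert b S" "e' \<in> insert b S" "e \<le> e'" for e e'
      proof (cases "e' = b")
        case True
        then show ?thesis using f[of e] mx that by (cases "e = b") auto
      next
        case False
        then show ?thesis using that fm[of e e'] lt[of e'] by auto
      qed
    qed (use M p in auto)
  qed
qed

text \<open>Passing to suitable marks in each row shortens the longest nest by one and costs a
  factor 3. The summand \<open>card C\<close> on the left makes this recursion purely
  multiplicative. Injectivity of \<open>r\<close> makes distinct rows strictly comparable, as
  \<open>nest\<close> requires.\<close>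

lemma no_nest_card_le:
  fixes A :: "('r \<times> nat) set" and r :: "'r \<Rightarrow> real"
  assumes "finite R" "finite C" "inj_on r R" "A \<subseteq> R \<times> C" "\<And>v a b. \<not> nest A r (Suc l) v a b"
  shows "card A + card C \<le> 3 ^ l * (card R + card C)"
  using assms(4,5)
proof (induction l arbitrary: A)
  case 0
  \<comment> \<open>Two entries in one row would already be a nest of length 1.\<close>
  have "inj_on fst A"
  proof (rule inj_onI)
    fix p q assume *: "p \<in> A" "q \<in> A" "fst p = fst q"
    then show "p = q"
      using 0(2)[of "\<lambda>_. fst p" "\<lambda>_. min (snd p) (snd q)" "\<lambda>_. max (snd p) (snd q)"]
      by (cases p; cases q; cases "snd p" "snd q" rule: linorder_cases) (auto simp: nest_def)
  qed
  then have "card A \<le> card R"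
    by (rule card_inj_on_le) (use 0(1) assms(1) in auto)
  then show ?case by simp
next
  case (Suc l)
  \<comment> \<open>The condition under which the columns \<open>s\<close> and \<open>e\<close> of
    row \<open>y\<close>, taken as the innermost pair of a nest, leave room for one more
    pair.\<close>
  define P where "P y s e \<longleftrightarrow> (\<exists>w c d. (w, c) \<in> A \<and> (w, d) \<in> A \<and> r y < r w \<and> s < c \<and> c < d \<and> d < e)"
    for y s e
  have Pmono: "P y s' e'" if "P y s e" "s' \<le> s" "e \<le> e'" for y s s' e e'
    using that unfolding P_def by (meson le_less_trans less_le_trans)
  have Pne: "\<not> P y e e" for y e by (auto simp: P_def)
  have finA: "finite A"
    using Suc.prems(1) assms by (meson finite_SigmaI finite_subset)
  define Q where "Q y M f \<longleftrightarrow> (\<forall>c\<in>M. (y, c) \<in> A) \<and> (\<forall>c. (y, c) \<in> A \<longrightarrow> f c \<in> M \<and> f c \<le> c \<and> \<not> P y (f c) c)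
     \<and> (\<forall>c d. (y, c) \<in> A \<longrightarrow> (y, d) \<in> A \<longrightarrow> c \<le> d \<longrightarrow> f c \<le> f d) \<and> (\<forall>s\<in>M. \<forall>s'\<in>M. s < s' \<longrightarrow> P y s s')"
    for y M f
  have "\<exists>M f. Q y M f" for y
  proof -
    have "{c. (y, c) \<in> A} \<subseteq> C" using Suc.prems(1) by auto
    then have fin: "finite {c. (y, c) \<in> A}" using assms(2) finite_subset by blast
    obtain M f where "M \<subseteq> {c. (y, c) \<in> A}"
      "\<And>e. e \<in> {c. (y, c) \<in> A} \<Longrightarrow> f e \<in> M \<and> f e \<le> e \<and> \<not> P y (f e) e"
      "\<And>e e'. e \<in> {c. (y, c) \<in> A} \<Longrightarrow> e' \<in> {c. (y, c) \<in> A} \<Longrightarrow> e \<le> e' \<Longrightarrow> f e \<le> f e'"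
      "\<And>s s'. s \<in> M \<Longrightarrow> s' \<in> M \<Longrightarrow> s < s' \<Longrightarrow> P y s s'"
      by (rule greedy_marks[OF fin, of "P y"]) (use Pmono[of y] Pne[of y] in \<open>blast+\<close>)
    then show ?thesis unfolding Q_def by (intro exI[of _ M] exI[of _ f]) auto
  qed
  then obtain M f where Q: "\<And>y. Q y (M y) (f y)" by metis
  then have
    M: "\<And>y c. c \<in> M y \<Longrightarrow> (y, c) \<in> A"
    and f: "\<And>y c. (y, c) \<in> A \<Longrightarrow> f y c \<in> M y \<and> f y c \<le> c \<and> \<not> P y (f y c) c"
    and fm: "\<And>y c d. (y, c) \<in> A \<Longrightarrow> (y, d) \<in> A \<Longrightarrow> c \<le> d \<Longrightarrow> f y c \<le> f y d"
    and p: "\<And>y s s'. s \<in> M y \<Longrightarrow> s' \<in> M y \<Longrightarrow> s < s' \<Longrightarrow> P y s s'"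
    unfolding Q_def by blast+
  \<comment> \<open>Two marks of a row enclose a pair of a higher row, so a nest of marks extends inwards; splitting
    each row at its marks leaves a matrix to which \<open>no_abba_card_le\<close> applies.\<close>
  define A1 where "A1 = {(y, s). s \<in> M y}"
  have A1A: "A1 \<subseteq> A" using M by (auto simp: A1_def)
  have "\<not> nest A1 r (Suc l) v a b" for v a b
  proof
    assume n: "nest A1 r (Suc l) v a b"
    then have "P (v l) (a l) (b l)" by (intro p) (auto simp: nest_def A1_def)
    then obtain w c d where "(w, c) \<in> A" "(w, d) \<in> A" "r (v l) < r w" "a l < c" "c < d" "d < b l"
      by (auto simp: P_def)
    then show False using nest_extend[OF n A1A] Suc.prems(2) by blast
  qed
  then have IH: "card A1 + card C \<le> 3 ^ l * (card R + card C)"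
    using Suc.IH A1A Suc.prems(1) by blast
  define B where "B = (\<lambda>(y, c). ((y, f y c), c)) ` A"
  have "card B = card A" unfolding B_def by (rule card_image) (auto simp: inj_on_def)
  moreover have "card B \<le> 3 * card A1 + card C"
  proof (rule no_abba_card_le[where r = "\<lambda>(y, s). r y"])
    show "finite A1" using A1A finA finite_subset by blast
    show "B \<subseteq> A1 \<times> C" using f Suc.prems(1) by (auto simp: B_def A1_def)
    fix x y :: "'r \<times> nat" and a b c d
    assume *: "(x, a) \<in> B" "(y, b) \<in> B" "(y, c) \<in> B" "(x, d) \<in> B" "x \<noteq> y"
      "(case x of (y, s) \<Rightarrow> r y) \<le> (case y of (y, s) \<Rightarrow> r y)" "a < b" "b < c" "c < d"
    obtain x1 s y1 t where xy: "x = (x1, s)" "y = (y1, t)" by fastforce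
    have A: "(x1, a) \<in> A" "(y1, b) \<in> A" "(y1, c) \<in> A" "(x1, d) \<in> A"
      and s: "s = f x1 a" "s = f x1 d" "t = f y1 b"
      using *(1-4) by (auto simp: B_def xy)
    show False
    \<comment> \<open>Classes of one original row cannot interleave, since \<open>f\<close> is
      monotone in the column. For different rows the enclosed pair yields \<open>P x1 s d\<close>,
      although \<open>d\<close> belongs to the class of the mark \<open>s\<close>.\<close>
    proof (cases "x1 = y1")
      case True
      then have "s \<le> t" "t \<le> s" using fm[of y1 a b] fm[of y1 b d] A s *(7-) True by auto
      then show False using True *(5) xy by simp
    next
      case False
      then have "r x1 \<noteq> r y1" using A assms(3) Suc.prems(1) by (auto simp: inj_on_def)
      then have "r x1 < r y1" using *(6) xy by auto
      then have "P x1 a d" using A *(7-) by (auto simp: P_def)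
      moreover have "s \<le> a" "\<not> P x1 s d" using f A s by metis+
      ultimately show False using Pmono by blast
    qed
  qed (use assms in auto)
  ultimately have "card A + card C \<le> 3 * (card A1 + card C)" by simp
  also have "\<dots> \<le> 3 * (3 ^ l * (card R + card C))" using IH by (intro mult_left_mono) auto
  finally show ?case by (simp add: mult.assoc)
qed

section \<open>Curves emanating from a vertical line\<close>

lemma sorted_enumeration:
  fixes f :: "'a \<Rightarrow> real"
  assumes "finite S"
  obtains pos where "bij_betw pos S {..<card S}"
    "\<And>x y. x \<in> S \<Longrightarrow> y \<in> S \<Longrightarrow> pos x \<le> pos y \<Longrightarrow> f x \<le> f y"
  using assms
proof (induction "card S" arbitrary: S thesis)
  case 0
  then have "S = {}" by simp
  then show ?case using 0(2)[of "\<lambda>_. 0"] by (auto simp: bij_betw_def)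
next
  case (Suc n)
  have "S \<noteq> {}" using Suc.hyps(2) by auto
  then obtain m where m: "m \<in> S" "\<And>y. y \<in> S \<Longrightarrow> f y \<le> f m"
    using obtains_MAX[OF Suc.prems(2), of f] Suc.prems(2) by (metis Max_ge finite_imageI imageI)
  have n: "n = card (S - {m})" using Suc.hyps(2) m(1) Suc.prems(2) by simp
  obtain pos where pos: "bij_betw pos (S - {m}) {..<n}"
    "\<And>x y. x \<in> S - {m} \<Longrightarrow> y \<in> S - {m} \<Longrightarrow> pos x \<le> pos y \<Longrightarrow> f x \<le> f y"
    using Suc.hyps(1)[OF n] Suc.prems(2) n by (metis finite_Diff)
  have lt: "pos x < n" if "x \<in> S" "x \<noteq> m" for x
    using pos(1) that by (auto simp: bij_betw_def)
  show ?case
  proof (rule Suc.prems(1)[of "pos(m := n)"])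
    have "bij_betw (pos(m := n)) (S - {m}) {..<n}"
      using pos(1) by (rule iffD1[OF bij_betw_cong, rotated]) auto
    moreover have "insert m (S - {m}) = S" using m(1) by auto
    ultimately show "bij_betw (pos(m := n)) S {..<card S}"
      using notIn_Un_bij_betw[of m "S - {m}" "pos(m := n)" "{..<n}"] Suc.hyps(2)[symmetric]
      by (simp add: lessThan_Suc)
    show "f x \<le> f y" if "x \<in> S" "y \<in> S" "(pos(m := n)) x \<le> (pos(m := n)) y" for x y
      using that m(2)[of x] pos(2)[of x y] lt[of y] by (cases "y = m"; cases "x = m") auto
  qed
qed

text \<open>Mirsky's dual of Dilworth's theorem. The minimal elements form an antichain, hence
  number at most \<open>q\<close>; a chain found among the remaining elements is extended downwards
  by a minimal element below its least member.\<close>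

lemma large_chain_exists:
  assumes "finite S" and irr: "\<And>x. \<not> R x x"
    and tr: "\<And>x y z. \<lbrakk>x \<in> S; y \<in> S; z \<in> S; R x y; R y z\<rbrakk> \<Longrightarrow> R x z"
    and anti: "\<And>T. \<lbrakk>T \<subseteq> S; \<And>x y. x \<in> T \<Longrightarrow> y \<in> T \<Longrightarrow> \<not> R x y\<rbrakk> \<Longrightarrow> card T \<le> q"
  obtains T where "T \<subseteq> S" "\<And>x y. x \<in> T \<Longrightarrow> y \<in> T \<Longrightarrow> x \<noteq> y \<Longrightarrow> R x y \<or> R y x"
    "card S \<le> q * card T"
  using assms(1) tr anti
proof (induction "card S" arbitrary: S thesis rule: less_induct)
  case less
  note tr = less.prems(3) and anti = less.prems(4)
  show ?case
  proof (cases "S = {}")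
    case True
    then show ?thesis using less.prems(1)[of "{}"] by simp
  next
    case False
    \<comment> \<open>The number of predecessors grows strictly along \<open>R\<close>, so
      minimising it produces minimal elements of \<open>S\<close> and the least element of a
      chain.\<close>
    define d where "d x = card {y \<in> S. R y x}" for x
    have d: "d x < d y" if "R x y" "x \<in> S" "y \<in> S" for x y
    proof -
      have "{z \<in> S. R z x} \<subseteq> {z \<in> S. R z y}" using tr that by blast
      moreover have "x \<in> {z \<in> S. R z y}" "x \<notin> {z \<in> S. R z x}" using that irr by auto
      ultimately have "{z \<in> S. R z x} \<subset> {z \<in> S. R z y}" by blast
      then show ?thesis unfolding d_def using less.prems(2) by (intro psubset_card_mono) auto
    qed
    define Mn where "Mn = {x \<in> S. \<forall>y\<in>S. \<not> R y x}"
    have min: "\<exists>y\<in>Mn. y = x \<or> R y x" if x: "x \<in> S" for x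
    proof (cases "x \<in> Mn")
      case False
      then have "{y \<in> S. R y x} \<noteq> {}" using x by (auto simp: Mn_def)
      then obtain y where y: "y \<in> S" "R y x" "\<And>z. z \<in> S \<Longrightarrow> R z x \<Longrightarrow> d y \<le> d z"
        using arg_min_if_finite[of "{y \<in> S. R y x}" d] less.prems(2)
        by (force simp: not_less)
      have "y \<in> Mn" unfolding Mn_def using y x tr[of _ y x] d[of _ y] by (force simp: not_le[symmetric])
      then show ?thesis using y by blast
    qed auto
    have "Mn \<noteq> {}" using False min by blast
    have MS: "Mn \<subseteq> S" by (auto simp: Mn_def)
    have "card Mn \<le> q" by (rule anti[OF MS]) (auto simp: Mn_def)
    have "card (S - Mn) < card S"
      using \<open>Mn \<noteq> {}\<close> MS less.prems(2) by (intro psubset_card_mono) auto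
    then obtain T where T: "T \<subseteq> S - Mn" "\<And>x y. x \<in> T \<Longrightarrow> y \<in> T \<Longrightarrow> x \<noteq> y \<Longrightarrow> R x y \<or> R y x"
      "card (S - Mn) \<le> q * card T"
    proof (rule less.hyps)
      show "finite (S - Mn)" using less.prems(2) by simp
      show "R x z" if "x \<in> S - Mn" "y \<in> S - Mn" "z \<in> S - Mn" "R x y" "R y z" for x y z
        using that tr by blast
      show "card T \<le> q" if "T \<subseteq> S - Mn" "\<And>x y. x \<in> T \<Longrightarrow> y \<in> T \<Longrightarrow> \<not> R x y" for T
        using that by (intro anti) auto
    qed blast
    have cS: "card S \<le> q + card (S - Mn)"
      using \<open>card Mn \<le> q\<close> diff_card_le_card_Diff[of Mn S] MS less.prems(2) finite_subset by fastforce
    have finT: "finite T" using T(1) less.prems(2) finite_subset by blast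
    show ?thesis
    proof (cases "T = {}")
      case True
      obtain x where "x \<in> S" using False by auto
      then show ?thesis using cS T(3) True by (intro less.prems(1)[of "{x}"]) auto
    next
      case False
      then obtain t where t: "t \<in> T" "\<And>z. z \<in> T \<Longrightarrow> d t \<le> d z"
        using arg_min_if_finite[OF finT False, of d] by (metis linorder_not_le)
      have tle: "t = z \<or> R t z" if "z \<in> T" for z
        using T(1,2) t d that by (metis DiffD1 leD subsetD)
      obtain y where y: "y \<in> Mn" "R y t"
        using min[of t] t(1) T(1) by blast
      have "R y z" if "z \<in> T" for z
        using tle[OF that] y tr[of y t z] MS T(1) t(1) that by blast
      moreover have "y \<notin> T" using y T(1) by blast
      ultimately show ?thesis using T cS finT y(1) MS
        by (intro less.prems(1)[of "insert y T"]) auto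
    qed
  qed
qed

text \<open>The factor \<open>k - 1\<close> is the cost of thinning the stars to disjoint arcs; the
  power of 3 is the bound of \<open>no_nest_card_le\<close> for nests of at most
  \<open>(k - 1)^2\<close> pairs.\<close>

definition star_const :: "nat \<Rightarrow> nat" where
  "star_const k = (k - 1) * 3 ^ ((k - 1)\<^sup>2)"

text \<open>The arc \<open>e\<close> is the graph of \<open>h e\<close> over \<open>[0, r (q e)]\<close>, where the parameter is the distance from
  the line; its apex \<open>q e\<close> lies at distance \<open>r (q e)\<close> and height \<open>y (q e)\<close>. Both halves of a
  family of edges cut by a vertical line have this form.\<close>

locale fan =
  fixes E :: "'e set" and q :: "'e \<Rightarrow> 'v" and V :: "'v set" and r y :: "'v \<Rightarrow> real"
    and h :: "'e \<Rightarrow> real \<Rightarrow> real" and meet :: "'e \<Rightarrow> 'e \<Rightarrow> bool" and k :: nat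
  assumes finE: "finite E" and finV: "finite V" and qV: "q ` E \<subseteq> V"
    and rpos: "e \<in> E \<Longrightarrow> 0 < r (q e)"
    and cont: "e \<in> E \<Longrightarrow> continuous_on {0..r (q e)} (h e)"
    and h_end: "e \<in> E \<Longrightarrow> h e (r (q e)) = y (q e)"
    and avoid: "\<lbrakk>e \<in> E; e' \<in> E; q e \<noteq> q e'; r (q e) \<le> r (q e')\<rbrakk> \<Longrightarrow> h e' (r (q e)) \<noteq> y (q e)"
    and meet_def: "meet e e' \<longleftrightarrow> (\<exists>t\<ge>0. t < r (q e) \<and> t < r (q e') \<and> h e t = h e' t)"
    and kpos: "1 \<le> k"
    and no_k_meet: "\<lbrakk>F \<subseteq> E; card F = k\<rbrakk> \<Longrightarrow> \<exists>e\<in>F. \<exists>e'\<in>F. e \<noteq> e' \<and> \<not> meet e e'"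
begin

section \<open>Meeting and disjoint arcs in a fan\<close>

lemma meet_sym: "meet e e' \<longleftrightarrow> meet e' e"
  by (auto simp: meet_def)

lemma pairwise_meet_card:
  assumes "T \<subseteq> E" "\<And>e e'. e \<in> T \<Longrightarrow> e' \<in> T \<Longrightarrow> e \<noteq> e' \<Longrightarrow> meet e e'"
  shows "card T \<le> k - 1"
proof (rule ccontr)
  assume "\<not> card T \<le> k - 1"
  then obtain F where "F \<subseteq> T" "card F = k"
    using obtain_subset_with_card_n[of k T] kpos by (metis Suc_pred' less_eq_Suc_le nat_le_linear not_less_eq_eq One_nat_def)
  then show False using no_k_meet[of F] assms by blast
qed

text \<open>Intermediate value theorem. The heights differ at \<open>s\<close>, so the common point
  comes strictly before \<open>s\<close> and hence before both apexes; a shared apex alone is not a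
  meeting.\<close>

lemma meetI:
  assumes "e \<in> E" "e' \<in> E" "h e 0 \<le> h e' 0" "0 \<le> s" "s \<le> r (q e)" "s \<le> r (q e')" "h e' s < h e s"
  shows "meet e e'"
proof -
  have "continuous_on {0..s} (\<lambda>t. h e' t - h e t)"
    using assms cont by (intro continuous_intros; meson atLeastatMost_subset_iff continuous_on_subset order_refl)
  then obtain t where "0 \<le> t" "t \<le> s" "h e' t - h e t = 0"
    using IVT2'[of "\<lambda>t. h e' t - h e t" s 0 0] assms by auto
  moreover then have "t \<noteq> s" using assms by auto
  ultimately show ?thesis unfolding meet_def using assms by (intro exI[of _ t]) auto
qed

lemma not_meet_less:
  assumes "e \<in> E" "e' \<in> E" "h e 0 \<le> h e' 0" "\<not> meet e e'" "0 \<le> t" "t < r (q e)" "t < r (q e')"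
  shows "h e t < h e' t"
proof -
  have "h e t \<noteq> h e' t" using assms by (auto simp: meet_def)
  moreover have "\<not> h e' t < h e t" using meetI[of e e' t] assms by auto
  ultimately show ?thesis by linarith
qed

text \<open>Disjoint arcs keep the order they have on the line. As \<open>e'\<close> reaches at
  least as far as \<open>e\<close>, it still separates \<open>e\<close> from \<open>e''\<close>
  wherever these two could meet.\<close>

lemma not_meet_trans:
  assumes "e \<in> E" "e' \<in> E" "e'' \<in> E" "h e 0 \<le> h e' 0" "h e' 0 \<le> h e'' 0"
    "r (q e) \<le> r (q e')" "\<not> meet e e'" "\<not> meet e' e''"
  shows "\<not> meet e e''"
proof
  assume "meet e e''"
  then obtain t where t: "0 \<le> t" "t < r (q e)" "t < r (q e'')" "h e t = h e'' t"
    by (auto simp: meet_def)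
  then have "h e t < h e' t" "h e' t < h e'' t"
    using assms not_meet_less[of e e' t] not_meet_less[of e' e'' t] by auto
  then show False using t by simp
qed

text \<open>Compare \<open>a'\<close> with the apex of \<open>a\<close> and \<open>b\<close> at the
  distance of that apex. If \<open>a'\<close> passes below it, \<open>a\<close> has to get from
  below \<open>a'\<close> to above it. If \<open>a'\<close> passes above it, so does
  \<open>b'\<close>, and \<open>b\<close> has to get from above \<open>b'\<close> to below it.
  Passing through the apex is excluded by \<open>avoid\<close>.\<close>

lemma nested_stars_meet:
  assumes "a \<in> E" "b \<in> E" "a' \<in> E" "b' \<in> E" "q a = q b" "q a' = q b'" "q a \<noteq> q a'"
    "r (q a) \<le> r (q a')" "h a 0 \<le> h a' 0" "h a' 0 \<le> h b' 0" "h b' 0 \<le> h b 0" "\<not> meet a' b'"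
  shows "meet a a' \<or> meet b b'"
proof -
  let ?s = "r (q a)"
  have s: "0 \<le> ?s" using rpos assms by fastforce
  have ends: "h a ?s = y (q a)" "h b ?s = y (q a)" using h_end assms by metis+
  have "h a' ?s \<noteq> y (q a)" using avoid assms by blast
  moreover have "meet a a'" if "h a' ?s < y (q a)"
    using meetI[of a a' ?s] that s ends assms by auto
  moreover have "meet b b'" if "y (q a) < h a' ?s"
  proof -
    \<comment> \<open>Equality can occur if both apexes are equally far from the line and
      \<open>a'\<close> and \<open>b'\<close> end here.\<close>
    have "h a' ?s \<le> h b' ?s"
      using meetI[of a' b' ?s] s assms by (metis linorder_not_le)
    then have "meet b' b"
      using meetI[of b' b ?s] s ends that assms by auto
    then show ?thesis by (simp add: meet_sym)
  qed
  ultimately show ?thesis by linarith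
qed

text \<open>Here \<open>p\<close> gives the block of an arc, and by injectivity the arcs are entries
  of the incidence matrix of apexes and blocks. Heights are compared only between distinct blocks,
  which is why \<open>nest\<close> has strict inequalities between columns.\<close>

lemma fan_card_le:
  fixes p :: "'e \<Rightarrow> nat"
  assumes E': "E' \<subseteq> E" and "finite C" "p ` E' \<subseteq> C"
    and mono: "\<And>e e'. \<lbrakk>e \<in> E'; e' \<in> E'; p e < p e'\<rbrakk> \<Longrightarrow> h e 0 \<le> h e' 0"
    and inj: "inj_on (\<lambda>e. (q e, p e)) E'"
  shows "card E' \<le> star_const k * (card V + card C)"
proof -
  have finE': "finite E'" using E' finE finite_subset by blast
  define star where "star v = {e \<in> E'. q e = v}" for v
  \<comment> \<open>Arcs of one star lie in distinct blocks, so incomparable ones in the order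
    "lower and disjoint" meet; antichains therefore have at most \<open>k - 1\<close>
    members.\<close>
  have "\<exists>T. T \<subseteq> star v \<and> (\<forall>e\<in>T. \<forall>e'\<in>T. e \<noteq> e' \<longrightarrow> \<not> meet e e') \<and> card (star v) \<le> (k - 1) * card T" for v
  proof -
    have pne: "p e \<noteq> p e'" if "e \<in> star v" "e' \<in> star v" "e \<noteq> e'" for e e'
      using inj that by (auto simp: inj_on_def star_def)
    obtain T where "T \<subseteq> star v"
      "\<And>e e'. e \<in> T \<Longrightarrow> e' \<in> T \<Longrightarrow> e \<noteq> e' \<Longrightarrow>
         (p e < p e' \<and> \<not> meet e e') \<or> (p e' < p e \<and> \<not> meet e' e)"
      "card (star v) \<le> (k - 1) * card T"
    proof (rule large_chain_exists[of "star v" "\<lambda>e e'. p e < p e' \<and> \<not> meet e e'" "k - 1"])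
      show "finite (star v)" using finE' by (simp add: star_def)
      show "p x < p z \<and> \<not> meet x z"
        if "x \<in> star v" "y \<in> star v" "z \<in> star v" "p x < p y \<and> \<not> meet x y" "p y < p z \<and> \<not> meet y z"
        for x y z
      proof -
        have "x \<in> E'" "y \<in> E'" "z \<in> E'" "q x = q y" using that by (auto simp: star_def)
        then show ?thesis using that(4,5) not_meet_trans[of x y z] mono[of x y] mono[of y z] E' by auto
      qed
      show "card T \<le> k - 1"
        if T: "T \<subseteq> star v" "\<And>x y. x \<in> T \<Longrightarrow> y \<in> T \<Longrightarrow> \<not> (p x < p y \<and> \<not> meet x y)" for T
      proof (rule pairwise_meet_card)
        show "T \<subseteq> E" using T E' by (auto simp: star_def)
        show "meet e e'" if "e \<in> T" "e' \<in> T" "e \<noteq> e'" for e e'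
          using pne[of e e'] T that meet_sym[of e e'] by (metis linorder_neqE_nat subsetD)
      qed
    qed auto
    then show ?thesis using meet_sym by blast
  qed
  then obtain T where T: "\<And>v. T v \<subseteq> star v"
    "\<And>v e e'. e \<in> T v \<Longrightarrow> e' \<in> T v \<Longrightarrow> e \<noteq> e' \<Longrightarrow> \<not> meet e e'"
    "\<And>v. card (star v) \<le> (k - 1) * card (T v)"
    by metis
  define E2 where "E2 = (\<Union>v\<in>V. T v)"
  have E2: "E2 \<subseteq> E'" using T(1) by (auto simp: E2_def star_def)
  have E2E: "E2 \<subseteq> E" using E2 E' by blast
  have qT: "q e = v" if "e \<in> T v" for e v using T(1) that by (auto simp: star_def)
  have fin_star: "finite (star v)" for v using finE' by (simp add: star_def)
  have finT: "finite (T v)" for v using fin_star T(1) finite_subset by blast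
  have "E' = (\<Union>v\<in>V. star v)" using qV E' by (auto simp: star_def)
  then have "card E' \<le> (\<Sum>v\<in>V. card (star v))" using card_UN_le[OF finV] by metis
  also have "\<dots> \<le> (\<Sum>v\<in>V. (k - 1) * card (T v))" using T(3) by (rule sum_mono)
  also have "\<dots> = (k - 1) * (\<Sum>v\<in>V. card (T v))" by (simp add: sum_distrib_left)
  also have "(\<Sum>v\<in>V. card (T v)) = card E2"
    unfolding E2_def
    by (rule card_UN_disjoint[symmetric]) (use finV finT qT in blast)+
  finally have cE': "card E' \<le> (k - 1) * card E2" .
  have star_free: "\<not> meet e e'" if "e \<in> E2" "e' \<in> E2" "q e = q e'" "e \<noteq> e'" for e e'
  proof -
    have "e \<in> T (q e)" "e' \<in> T (q e')" using that qT by (auto simp: E2_def)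
    then show ?thesis using T(2) that by metis
  qed
  \<comment> \<open>Apexes may be equally far from the line, so their ranks replace the distances as
    an injective key.\<close>
  obtain pos where pos: "bij_betw pos V {..<card V}"
    "\<And>x z. x \<in> V \<Longrightarrow> z \<in> V \<Longrightarrow> pos x \<le> pos z \<Longrightarrow> r x \<le> r z"
    using sorted_enumeration[OF finV, of r] by blast
  define A where "A = (\<lambda>e. (q e, p e)) ` E2"
  define l where "l = (k - 1)\<^sup>2"
  have "\<not> nest A (\<lambda>v. real (pos v)) (Suc l) v a b" for v a b
  proof
    assume n: "nest A (\<lambda>v. real (pos v)) (Suc l) v a b"
    have AE: "\<exists>e. e \<in> E2 \<and> q e = u \<and> p e = c" if "(u, c) \<in> A" for u c
      using that by (auto simp: A_def)
    have "\<forall>i\<in>{..<Suc l}. \<exists>e. e \<in> E2 \<and> q e = v i \<and> p e = a i"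
      "\<forall>i\<in>{..<Suc l}. \<exists>e. e \<in> E2 \<and> q e = v i \<and> p e = b i"
      using n AE by (auto simp: nest_def)
    then obtain ea eb where
      ea: "\<And>i. i < Suc l \<Longrightarrow> ea i \<in> E2 \<and> q (ea i) = v i \<and> p (ea i) = a i" and
      eb: "\<And>i. i < Suc l \<Longrightarrow> eb i \<in> E2 \<and> q (eb i) = v i \<and> p (eb i) = b i"
      unfolding bchoice_iff by auto
    have eaE: "ea i \<in> E" and ebE: "eb i \<in> E" if "i < Suc l" for i
      using ea[OF that] eb[OF that] E2E by auto
    have ab: "a i < b i" if "i < Suc l" for i using n that by (simp add: nest_def)
    have ord: "pos (v i) < pos (v j)" "a i < a j" "b j < b i" if "i < j" "j < Suc l" for i j
      using n that by (auto simp: nest_def)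
    have vV: "v i \<in> V" if "i < Suc l" for i using ea[OF that] E2E qV by (metis image_subset_iff subsetD)
    have rle: "r (v i) \<le> r (v j)" if "i < j" "j < Suc l" for i j
      using pos(2)[of "v i" "v j"] ord(1)[OF that] vV that by auto
    have h0: "h (ea i) 0 \<le> h (ea j) 0" "h (eb j) 0 \<le> h (eb i) 0" if "i < j" "j < Suc l" for i j
    proof -
      have i: "i < Suc l" using that by simp
      show "h (ea i) 0 \<le> h (ea j) 0"
        using ord(2)[OF that] ea[OF i] ea[OF that(2)] E2 by (intro mono) auto
      show "h (eb j) 0 \<le> h (eb i) 0"
        using ord(3)[OF that] eb[OF i] eb[OF that(2)] E2 by (intro mono) auto
    qed
    have meets: "meet (ea i) (ea j) \<or> meet (eb i) (eb j)" if ij: "i < j" "j < Suc l" for i j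
    proof (rule nested_stars_meet)
      have i: "i < Suc l" using ij by simp
      note e = ea[OF i] ea[OF ij(2)] eb[OF i] eb[OF ij(2)]
      show "ea i \<in> E" "eb i \<in> E" "ea j \<in> E" "eb j \<in> E" "q (ea i) = q (eb i)" "q (ea j) = q (eb j)"
        using e E2E by auto
      show "q (ea i) \<noteq> q (ea j)" using e ord(1)[OF ij] by auto
      show "r (q (ea i)) \<le> r (q (ea j))" using e rle[OF ij] by simp
      show "h (ea i) 0 \<le> h (ea j) 0" "h (eb j) 0 \<le> h (eb i) 0" using h0 ij by auto
      show "h (ea j) 0 \<le> h (eb j) 0" using e ab[OF ij(2)] E2 by (intro mono) auto
      have "ea j \<noteq> eb j" using e ab[OF ij(2)] by auto
      then show "\<not> meet (ea j) (eb j)" using star_free e by metis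
    qed
    have inj_a: "i = j" if "i < Suc l" "j < Suc l" "a i = a j \<or> b i = b j" for i j
      using that ord(2,3)[of i j] ord(2,3)[of j i] by (cases i j rule: linorder_cases) auto
    have inja: "inj_on ea {..<Suc l}" and injb: "inj_on eb {..<Suc l}"
      using inj_a ea eb by (metis inj_onI lessThan_iff)+
    \<comment> \<open>Antichains of indices have pairwise meeting lower arcs, so some chain
      \<open>I\<close> satisfies \<open>(k - 1)^2 + 1 \<le> (k - 1) * card I\<close>. On
      \<open>I\<close> the lower arcs are disjoint, so \<open>meets\<close> makes the upper arcs
      pairwise meet and forces \<open>card I \<le> k - 1\<close>.\<close>
    obtain I where I: "I \<subseteq> {..<Suc l}"
      "\<And>i j. i \<in> I \<Longrightarrow> j \<in> I \<Longrightarrow> i \<noteq> j \<Longrightarrow>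
         (i < j \<and> \<not> meet (ea i) (ea j)) \<or> (j < i \<and> \<not> meet (ea j) (ea i))"
      "card {..<Suc l} \<le> (k - 1) * card I"
    proof (rule large_chain_exists[of "{..<Suc l}" "\<lambda>i j. i < j \<and> \<not> meet (ea i) (ea j)" "k - 1"])
      show "i < m \<and> \<not> meet (ea i) (ea m)"
        if "i \<in> {..<Suc l}" "j \<in> {..<Suc l}" "m \<in> {..<Suc l}"
          "i < j \<and> \<not> meet (ea i) (ea j)" "j < m \<and> \<not> meet (ea j) (ea m)" for i j m
      proof -
        have "i < Suc l" "j < Suc l" "m < Suc l" "i < j" "j < m" using that by auto
        then show ?thesis
          using that(4,5) not_meet_trans[of "ea i" "ea j" "ea m"] h0 rle[of i j] ea[of i] ea[of j] eaE
          by auto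
      qed
      show "card J \<le> k - 1"
        if J: "J \<subseteq> {..<Suc l}" "\<And>i j. i \<in> J \<Longrightarrow> j \<in> J \<Longrightarrow> \<not> (i < j \<and> \<not> meet (ea i) (ea j))" for J
      proof -
        have "card (ea ` J) \<le> k - 1"
        proof (rule pairwise_meet_card)
          show "ea ` J \<subseteq> E" using J eaE by auto
          show "meet e e'" if "e \<in> ea ` J" "e' \<in> ea ` J" "e \<noteq> e'" for e e'
            using that J(2) meet_sym by (metis imageE linorder_neqE_nat)
        qed
        then show ?thesis using card_image[OF inj_on_subset[OF inja J(1)]] by simp
      qed
    qed auto
    have "card (eb ` I) \<le> k - 1"
    proof (rule pairwise_meet_card)
      show "eb ` I \<subseteq> E" using I(1) ebE by auto
      show "meet e e'" if ee: "e \<in> eb ` I" "e' \<in> eb ` I" "e \<noteq> e'" for e e'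
      proof -
        obtain i j where ij: "i \<in> I" "j \<in> I" "e = eb i" "e' = eb j" using ee by auto
        then have "i \<noteq> j" "i < Suc l" "j < Suc l" using ee I(1) by auto
        then show ?thesis using meets[of i j] meets[of j i] I(2)[OF ij(1,2)] ij meet_sym by metis
      qed
    qed
    then have "card I \<le> k - 1" using card_image[OF inj_on_subset[OF injb I(1)]] by simp
    then have "(k - 1) * card I \<le> l" by (simp add: l_def power2_eq_square)
    then show False using I(3) by simp
  qed
  then have "card A + card C \<le> 3 ^ l * (card V + card C)"
  proof (intro no_nest_card_le)
    show "inj_on (\<lambda>v. real (pos v)) V" using pos(1) by (auto simp: bij_betw_def inj_on_def)
    show "A \<subseteq> V \<times> C" unfolding A_def using E2 E2E qV assms(3) by blast
  qed (use finV assms in auto)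
  moreover have "card A = card E2" unfolding A_def by (rule card_image[OF inj_on_subset[OF inj E2]])
  ultimately have "card E2 \<le> 3 ^ l * (card V + card C)" by simp
  then have "(k - 1) * card E2 \<le> (k - 1) * (3 ^ l * (card V + card C))" by (rule mult_left_mono) simp
  with cE' have "card E' \<le> (k - 1) * (3 ^ l * (card V + card C))" by (rule order_trans)
  then show ?thesis unfolding l_def star_const_def by (simp only: mult.assoc)
qed

text \<open>Double counting of the pairs of an apex and a block containing an arc to it: at least
  \<open>2 * star_const k\<close> per block, but at most
  \<open>star_const k * (card V + card B)\<close> in total. The factor 2 absorbs the term
  \<open>card B\<close>.\<close>

lemma rich_blocks_card_le:
  fixes p :: "'e \<Rightarrow> nat"
  assumes "2 \<le> k" "finite B"
    and mono: "\<And>e e'. \<lbrakk>e \<in> E; e' \<in> E; p e < p e'\<rbrakk> \<Longrightarrow> h e 0 \<le> h e' 0"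
    and rich: "\<And>b. b \<in> B \<Longrightarrow> 2 * star_const k \<le> card (q ` {e \<in> E. p e = b})"
  shows "card B \<le> card V"
proof -
  define W where "W = (SIGMA b:B. q ` {e \<in> E. p e = b})"
  have cW: "card W = (\<Sum>b\<in>B. card (q ` {e \<in> E. p e = b}))"
    unfolding W_def using assms(2) finE by (intro card_SigmaI) auto
  have "2 * star_const k * card B = (\<Sum>b\<in>B. 2 * star_const k)" by simp
  also have "\<dots> \<le> card W" unfolding cW using rich by (rule sum_mono)
  also have "\<dots> = card (prod.swap ` W)" by (simp add: card_image)
  finally have W: "2 * star_const k * card B \<le> card (prod.swap ` W)" .
  \<comment> \<open>One arc is chosen for each pair, which makes the family injective as
    \<open>fan_card_le\<close> demands.\<close>
  have "prod.swap ` W \<subseteq> (\<lambda>e. (q e, p e)) ` E" by (auto simp: W_def)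
  then obtain E' where E': "E' \<subseteq> E" "inj_on (\<lambda>e. (q e, p e)) E'" "prod.swap ` W = (\<lambda>e. (q e, p e)) ` E'"
    unfolding subset_image_inj by blast
  have "p ` E' = snd ` (prod.swap ` W)" unfolding E'(3) by (simp add: image_image)
  then have "p ` E' \<subseteq> B" by (auto simp: W_def)
  then have "card E' \<le> star_const k * (card V + card B)"
    using E' assms(2) mono by (intro fan_card_le[of E' B p]; blast)
  moreover have "2 * star_const k * card B \<le> card E'" using W card_image[OF E'(2)] E'(3) by simp
  ultimately have "star_const k * card B \<le> star_const k * card V"
    unfolding add_mult_distrib2 mult.assoc by linarith
  moreover have "star_const k > 0" using assms(1) by (simp add: star_const_def)
  ultimately show ?thesis by simp
qed

end

section \<open>Edges crossing a vertical line\<close>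

lemma edges_crossI:
  assumes "e \<noteq> e'" "fst (fst e) < x" "x < fst (snd e)" "fst (fst e') < x" "x < fst (snd e')"
    "g (fst e) (snd e) x = g (fst e') (snd e') x"
  shows "edges_cross g e e'"
proof -
  have "(x, g (fst e) (snd e) x) \<in> interior_pts g e \<inter> interior_pts g e'"
    using assms by (auto simp: interior_pts_def curve_def image_iff prod_eq_iff)
  then show ?thesis using assms(1) by (auto simp: edges_cross_def)
qed

text \<open>The left half is the mirror image of the right one. A meeting of two halves lies
  strictly between the endpoints of both edges, so it is a crossing, and quasi-planarity bounds
  pairwise meeting families.\<close>

lemma line_fans:
  assumes G: "xmono_topological_graph V E g" and Q: "quasi_planar k E g" and "1 \<le> k"
    and E': "E' \<subseteq> E" "\<And>e. e \<in> E' \<Longrightarrow> fst (fst e) < x \<and> x < fst (snd e)"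
  shows right_fan: "fan E' snd V (\<lambda>v. fst v - x) snd (\<lambda>e t. g (fst e) (snd e) (x + t))
      (\<lambda>e e'. \<exists>t\<ge>0. t < fst (snd e) - x \<and> t < fst (snd e') - x \<and>
         g (fst e) (snd e) (x + t) = g (fst e') (snd e') (x + t)) k" (is ?right)
    and left_fan: "fan E' fst V (\<lambda>v. x - fst v) snd (\<lambda>e t. g (fst e) (snd e) (x - t))
      (\<lambda>e e'. \<exists>t\<ge>0. t < x - fst (fst e) \<and> t < x - fst (fst e') \<and>
         g (fst e) (snd e) (x - t) = g (fst e') (snd e') (x - t)) k" (is ?left)
proof -
  have VE: "finite V" "E \<subseteq> V \<times> V" using G by (auto simp: xmono_topological_graph_def)
  then have finE': "finite E'" using E' by (meson finite_SigmaI finite_subset)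
  have V: "fst e \<in> V" "snd e \<in> V" if "e \<in> E'" for e
  proof -
    have "e \<in> V \<times> V" using that E'(1) VE(2) by blast
    then show "fst e \<in> V" "snd e \<in> V" by (simp_all add: mem_Times_iff)
  qed
  have arc: "continuous_on {fst (fst e)..fst (snd e)} (g (fst e) (snd e))"
    "g (fst e) (snd e) (fst (fst e)) = snd (fst e)" "g (fst e) (snd e) (fst (snd e)) = snd (snd e)"
    if "e \<in> E'" for e
  proof -
    have "\<forall>(u,v)\<in>E. fst u < fst v \<and> continuous_on {fst u .. fst v} (g u v)
        \<and> g u v (fst u) = snd u \<and> g u v (fst v) = snd v"
      using G unfolding xmono_topological_graph_def by blast
    moreover have "e \<in> E" using that E'(1) by blast
    ultimately show "continuous_on {fst (fst e)..fst (snd e)} (g (fst e) (snd e))"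
      "g (fst e) (snd e) (fst (fst e)) = snd (fst e)" "g (fst e) (snd e) (fst (snd e)) = snd (snd e)"
      by (auto simp: split_beta)
  qed
  have off: "g (fst e) (snd e) (fst w) \<noteq> snd w"
    if "e \<in> E'" "w \<in> V" "w \<noteq> fst e" "w \<noteq> snd e" "fst (fst e) \<le> fst w" "fst w \<le> fst (snd e)" for e w
  proof
    assume "g (fst e) (snd e) (fst w) = snd w"
    then have "w \<in> curve g e" using that(5,6) by (force simp: curve_def image_iff prod_eq_iff)
    moreover have "e \<in> E" using that(1) E'(1) by blast
    ultimately show False using G that(2,3,4) unfolding xmono_topological_graph_def by blast
  qed
  have cr: "\<exists>e\<in>F. \<exists>e'\<in>F. e \<noteq> e' \<and> \<not> edges_cross g e e'" if "F \<subseteq> E'" "card F = k" for F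
  proof -
    have "F \<subseteq> E" using that E'(1) by blast
    then show ?thesis using Q that(2) unfolding quasi_planar_def by blast
  qed
  show ?right
  proof (unfold_locales, goal_cases)
    case (5 e)
    show ?case
      by (rule continuous_on_compose2[OF arc(1)[OF 5]]) (use E'(2)[OF 5] in \<open>auto intro!: continuous_intros\<close>)
  next
    case (7 e e')
    \<comment> \<open>The endpoints \<open>snd e\<close> and \<open>fst e'\<close> lie on opposite
      sides of the line. So \<open>snd e\<close> is neither endpoint of \<open>e'\<close>, and
      \<open>e'\<close> cannot pass through it.\<close>
    moreover from this have "snd e \<noteq> fst e'" using E'(2) by (metis less_asym)
    ultimately show ?case using off[of e' "snd e"] V[of e] E'(2)[of e] E'(2)[of e'] by auto
  next
    case (10 F)
    then show ?case using cr[of F] E'(2) edges_crossI[of _ _ _ g] by (smt (verit) subsetD)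
  qed (use finE' VE V E' arc assms(3) in auto)
  show ?left
  proof (unfold_locales, goal_cases)
    case (5 e)
    show ?case
      by (rule continuous_on_compose2[OF arc(1)[OF 5]]) (use E'(2)[OF 5] in \<open>auto intro!: continuous_intros\<close>)
  next
    case (7 e e')
    moreover from this have "fst e \<noteq> snd e'" using E'(2) by (metis less_asym)
    ultimately show ?case using off[of e' "fst e"] V[of e] E'(2)[of e] E'(2)[of e'] by auto
  next
    case (10 F)
    then show ?case using cr[of F] E'(2) edges_crossI[of _ _ _ g] by (smt (verit) subsetD)
  qed (use finE' VE V E' arc assms(3) in auto)
qed

text \<open>At most \<open>card V\<close> full blocks are rich in right endpoints and at most
  \<open>card V\<close> in left endpoints; the summand 1 pays for the incomplete last block.\<close>

lemma line_edges_card_le: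
  assumes G: "xmono_topological_graph V E g" and Q: "quasi_planar k E g" and "2 \<le> k"
    and E': "E' \<subseteq> E" "\<And>e. e \<in> E' \<Longrightarrow> fst (fst e) < x \<and> x < fst (snd e)"
  shows "card E' \<le> (2 * card V + 1) * (2 * star_const k)\<^sup>2"
proof -
  \<comment> \<open>The richness threshold of \<open>rich_blocks_card_le\<close>.\<close>
  define D where "D = 2 * star_const k"
  have D: "D > 0" using assms(3) by (simp add: D_def star_const_def)
  have VE: "finite V" "E \<subseteq> V \<times> V" using G by (auto simp: xmono_topological_graph_def)
  then have finE': "finite E'" using E' by (meson finite_SigmaI finite_subset)
  obtain pos where bij: "bij_betw pos E' {..<card E'}"
    and pos: "\<And>e e'. e \<in> E' \<Longrightarrow> e' \<in> E' \<Longrightarrow> pos e \<le> pos e' \<Longrightarrow>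
      g (fst e) (snd e) x \<le> g (fst e') (snd e') x"
    using sorted_enumeration[OF finE', of "\<lambda>e. g (fst e) (snd e) x"] by blast
  define p where "p e = pos e div D\<^sup>2" for e
  define block where "block b = {e \<in> E'. p e = b}" for b
  define M where "M = card E' div D\<^sup>2"
  have mono: "g (fst e) (snd e) x \<le> g (fst e') (snd e') x" if "e \<in> E'" "e' \<in> E'" "p e < p e'" for e e'
    using pos[OF that(1,2)] that(3) div_le_mono[of "pos e'" "pos e" "D\<^sup>2"] by (force simp: p_def)
  have blk: "D\<^sup>2 \<le> card (block b)" if "b < M" for b
  proof -
    have "{b * D\<^sup>2..<b * D\<^sup>2 + D\<^sup>2} \<subseteq> pos ` block b"
    proof
      fix i assume i: "i \<in> {b * D\<^sup>2..<b * D\<^sup>2 + D\<^sup>2}"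
      have "Suc b * D\<^sup>2 \<le> M * D\<^sup>2" using that by (intro mult_right_mono) auto
      also have "\<dots> \<le> card E'" by (simp add: M_def)
      finally have "i \<in> pos ` E'" using i bij by (auto simp: bij_betw_def)
      moreover have "i div D\<^sup>2 = b" using i D by (auto intro!: div_nat_eqI simp: mult.commute)
      ultimately show "i \<in> pos ` block b" by (auto simp: block_def p_def)
    qed
    then have "card {b * D\<^sup>2..<b * D\<^sup>2 + D\<^sup>2} \<le> card (pos ` block b)"
      using finE' by (intro card_mono) (auto simp: block_def)
    also have "\<dots> \<le> card (block b)" using finE' by (intro card_image_le) (auto simp: block_def)
    finally show ?thesis by simp
  qed
  define BR where "BR = {b \<in> {..<M}. D \<le> card (snd ` block b)}"
  define BL where "BL = {b \<in> {..<M}. D \<le> card (fst ` block b)}"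
  have "{..<M} \<subseteq> BR \<union> BL"
  proof
    fix b assume b: "b \<in> {..<M}"
    have fin: "finite (block b)" using finE' by (simp add: block_def)
    \<comment> \<open>An edge is the pair of its endpoints, so \<open>D^2\<close> edges cannot have
      fewer than \<open>D\<close> endpoints on both sides.\<close>
    have "block b \<subseteq> fst ` block b \<times> snd ` block b" by force
    then have "card (block b) \<le> card (fst ` block b) * card (snd ` block b)"
      using fin by (metis card_cartesian_product card_mono finite_SigmaI finite_imageI)
    then have "D * D \<le> card (fst ` block b) * card (snd ` block b)"
      using blk b by (fastforce simp: power2_eq_square)
    then have "D \<le> card (fst ` block b) \<or> D \<le> card (snd ` block b)"
      by (metis mult_strict_mono' linorder_not_le zero_le)
    then show "b \<in> BR \<union> BL" using b by (auto simp: BR_def BL_def)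
  qed
  then have "card {..<M} \<le> card (BR \<union> BL)" by (intro card_mono) (auto simp: BR_def BL_def)
  also have "\<dots> \<le> card BR + card BL" by (rule card_Un_le)
  also have "card BR \<le> card V"
  proof (rule fan.rich_blocks_card_le[OF right_fan[OF G Q _ E']])
    show "2 * star_const k \<le> card (snd ` {e \<in> E'. p e = b})" if "b \<in> BR" for b
      using that by (simp add: BR_def D_def block_def)
  qed (use assms(3) mono in \<open>auto simp: BR_def\<close>)
  also have "card BL \<le> card V"
  proof (rule fan.rich_blocks_card_le[OF left_fan[OF G Q _ E']])
    show "2 * star_const k \<le> card (fst ` {e \<in> E'. p e = b})" if "b \<in> BL" for b
      using that by (simp add: BL_def D_def block_def)
  qed (use assms(3) mono in \<open>auto simp: BL_def\<close>)
  finally have "M \<le> 2 * card V" by simp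
  have "card E' \<le> (M + 1) * D\<^sup>2"
  proof -
    have "card E' mod D\<^sup>2 < D\<^sup>2" using D by simp
    then show ?thesis using div_mult_mod_eq[of "card E'" "D\<^sup>2"] by (simp add: M_def)
  qed
  also have "\<dots> \<le> (2 * card V + 1) * D\<^sup>2" using \<open>M \<le> 2 * card V\<close> by (intro mult_right_mono) auto
  finally show ?thesis by (simp add: D_def)
qed

section \<open>Divide and conquer\<close>

text \<open>Take the value at rank \<open>card V div 2\<close>; equal values only make the two
  strict sides smaller.\<close>

lemma median_exists:
  fixes f :: "'a \<Rightarrow> real"
  assumes "finite V" "V \<noteq> {}"
  obtains x where "2 * card {v \<in> V. f v < x} \<le> card V" "2 * card {v \<in> V. x < f v} \<le> card V"
proof -
  obtain pos where bij: "bij_betw pos V {..<card V}"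
    and pos: "\<And>v w. v \<in> V \<Longrightarrow> w \<in> V \<Longrightarrow> pos v \<le> pos w \<Longrightarrow> f v \<le> f w"
    using sorted_enumeration[OF assms(1), of f] by blast
  let ?n = "card V"
  have "?n div 2 < ?n" using assms by (simp add: card_gt_0_iff)
  then have "?n div 2 \<in> pos ` V" using bij by (simp add: bij_betw_def)
  then obtain m where m: "m \<in> V" "pos m = ?n div 2" by auto
  have lt: "pos v < ?n" if "v \<in> V" for v using bij that by (auto simp: bij_betw_def)
  have inj: "inj_on pos {v \<in> V. P v}" for P
    using bij by (auto simp: bij_betw_def inj_on_def)
  have "card {v \<in> V. f v < f m} \<le> card {..<?n div 2}"
    by (rule card_inj_on_le[OF inj]) (use pos m in \<open>auto simp: not_le[symmetric]\<close>)
  moreover have "card {v \<in> V. f m < f v} \<le> card {?n div 2<..<?n}"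
    by (rule card_inj_on_le[OF inj]) (use pos m lt in \<open>auto simp: not_le[symmetric]\<close>)
  ultimately show ?thesis by (intro that[of "f m"]) auto
qed

lemma xmono_topological_graph_subset:
  assumes "xmono_topological_graph V E g" "V' \<subseteq> V" "E' \<subseteq> E" "E' \<subseteq> V' \<times> V'"
  shows "xmono_topological_graph V' E' g"
  unfolding xmono_topological_graph_def
proof (intro conjI)
  show "finite V'" using assms(1,2) unfolding xmono_topological_graph_def by (blast intro: finite_subset)
  show "E' \<subseteq> V' \<times> V'" by fact
qed (use assms in \<open>unfold xmono_topological_graph_def, blast+\<close>)

lemma quasi_planar_subset: "quasi_planar k E g \<Longrightarrow> E' \<subseteq> E \<Longrightarrow> quasi_planar k E' g"
  unfolding quasi_planar_def by blast

text \<open>Halving lowers the logarithm by 1, and this gain pays for the edges cut at the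
  median.\<close>

lemma half_mult_log_le:
  fixes a n :: nat
  assumes "2 * a \<le> n"
  shows "real a * log 2 (real a) \<le> real a * (log 2 (real n) - 1)"
proof (cases "a = 0")
  case False
  have "log 2 (real a) \<le> log 2 (real n / 2)" using False assms by simp
  also have "\<dots> = log 2 (real n) - 1" using False assms by (simp add: log_divide)
  finally show ?thesis by (intro mult_left_mono) auto
qed simp

text \<open>The 6 comes from two cuts, each with at most 3 times
  \<open>(2 * star_const k)^2 * card V\<close> edges.\<close>

lemma edges_card_le_n_log_n:
  assumes "2 \<le> k" "xmono_topological_graph V E g" "quasi_planar k E g"
  shows "real (card E) \<le> 6 * real ((2 * star_const k)\<^sup>2) * real (card V) * log 2 (real (card V))"
  using assms(2,3)
proof (induction "card V" arbitrary: V E rule: less_induct)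
  case less
  note G = less.prems(1) and Q = less.prems(2)
  let ?K = "real ((2 * star_const k)\<^sup>2)" and ?n = "card V"
  have VE: "finite V" "E \<subseteq> V \<times> V" and x_less: "\<And>u v. (u, v) \<in> E \<Longrightarrow> fst u < fst v"
    using G by (auto simp: xmono_topological_graph_def)
  have finE: "finite E" using VE by (meson finite_SigmaI finite_subset)
  show ?case
  proof (cases "?n \<le> 1")
    case True
    have "E = {}"
    proof (rule ccontr)
      assume "E \<noteq> {}"
      then obtain u v where uv: "(u, v) \<in> E" by auto
      then have "u \<in> V" "v \<in> V" using VE(2) by auto
      then have "u = v" using card_le_Suc0_iff_eq[OF VE(1)] True by simp
      then show False using x_less[OF uv] by simp
    qed
    \<comment> \<open>The bound is 0 in both cases: the factor \<open>card V\<close> vanishes, or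
      the logarithm of 1 does.\<close>
    moreover have "?n = 0 \<or> ?n = 1" using True by linarith
    ultimately show ?thesis by auto
  next
    case False
    then have "V \<noteq> {}" by auto
    then obtain x where x: "2 * card {v \<in> V. fst v < x} \<le> ?n" "2 * card {v \<in> V. x < fst v} \<le> ?n"
      using median_exists[OF VE(1), of fst] by blast
    define VL VR where "VL = {v \<in> V. fst v < x}" and "VR = {v \<in> V. x < fst v}"
    define EL ER where "EL = E \<inter> VL \<times> VL" and "ER = E \<inter> VR \<times> VR"
    have VLR: "VL \<subseteq> V" "VR \<subseteq> V" by (auto simp: VL_def VR_def)
    have half: "2 * card VL \<le> ?n" "2 * card VR \<le> ?n" using x by (auto simp: VL_def VR_def)
    have "card (VL \<union> VR) \<le> ?n" using VE(1) VLR by (intro card_mono) auto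
    moreover have "card (VL \<union> VR) = card VL + card VR"
      using VE(1) by (intro card_Un_disjoint) (auto simp: VL_def VR_def)
    ultimately have sum: "card VL + card VR \<le> ?n" by simp
    have L: "real (card EL) \<le> 6 * ?K * real (card VL) * log 2 (real (card VL))"
      using half(1) False VLR G Q
      by (intro less.hyps xmono_topological_graph_subset[OF G] quasi_planar_subset[OF Q]) (auto simp: EL_def)
    have R: "real (card ER) \<le> 6 * ?K * real (card VR) * log 2 (real (card VR))"
      using half(2) False VLR G Q
      by (intro less.hyps xmono_topological_graph_subset[OF G] quasi_planar_subset[OF Q]) (auto simp: ER_def)
    \<comment> \<open>Many vertices may lie on the median line itself, and edges ending there do not cross it;
      hence two cuts, just left and just right of it.\<close>
    have "\<exists>x1<x. \<forall>v\<in>VL. fst v < x1"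
    proof -
      have "Max (insert (x - 1) (fst ` VL)) < x" using VE(1) by (auto simp: VL_def)
      then obtain x1 where "Max (insert (x - 1) (fst ` VL)) < x1" "x1 < x" using dense by blast
      then show ?thesis using VE(1) by (auto simp: VL_def)
    qed
    then obtain x1 where x1: "x1 < x" "\<And>v. v \<in> VL \<Longrightarrow> fst v < x1" by blast
    have "\<exists>x2>x. \<forall>v\<in>VR. x2 < fst v"
    proof -
      have "x < Min (insert (x + 1) (fst ` VR))" using VE(1) by (auto simp: VR_def)
      then obtain x2 where "x < x2" "x2 < Min (insert (x + 1) (fst ` VR))" using dense by blast
      then show ?thesis using VE(1) by (auto simp: VR_def)
    qed
    then obtain x2 where x2: "x < x2" "\<And>v. v \<in> VR \<Longrightarrow> x2 < fst v" by blast
    define cut where "cut z = {e \<in> E. fst (fst e) < z \<and> z < fst (snd e)}" for z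
    have cut: "real (card (cut z)) \<le> 3 * ?K * real ?n" for z
    proof -
      have "card (cut z) \<le> (2 * ?n + 1) * (2 * star_const k)\<^sup>2"
        by (rule line_edges_card_le[OF G Q assms(1), of _ z]) (auto simp: cut_def)
      also have "\<dots> \<le> (3 * ?n) * (2 * star_const k)\<^sup>2" using False by (intro mult_right_mono) auto
      finally have "real (card (cut z)) \<le> real ((3 * ?n) * (2 * star_const k)\<^sup>2)" by (rule of_nat_mono)
      then show ?thesis by (simp only: of_nat_mult of_nat_numeral ac_simps)
    qed
    have "E \<subseteq> EL \<union> ER \<union> (cut x1 \<union> cut x2)"
    proof
      fix e assume e: "e \<in> E"
      obtain u v where uv: "e = (u, v)" by (cases e)
      have V: "u \<in> V" "v \<in> V" and less: "fst u < fst v" using e uv VE x_less by auto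
      \<comment> \<open>Edges from the left side to the median or beyond cross \<open>x1\<close>;
        edges starting on the median end to its right and cross \<open>x2\<close>.\<close>
      consider "fst v < x" | "x < fst u" | "fst u < x" "x \<le> fst v" | "fst u = x"
        using less by linarith
      then show "e \<in> EL \<union> ER \<union> (cut x1 \<union> cut x2)"
      proof cases
        case 3
        then show ?thesis using x1(1) x1(2)[of u] V e uv by (auto simp: cut_def VL_def)
      next
        case 4
        then show ?thesis using x2(1) x2(2)[of v] V e uv less by (auto simp: cut_def VR_def)
      qed (use V e uv less in \<open>auto simp: EL_def ER_def VL_def VR_def\<close>)
    qed
    then have "card E \<le> card (EL \<union> ER \<union> (cut x1 \<union> cut x2))"
      using finE by (intro card_mono) (auto simp: EL_def ER_def cut_def)
    also have "\<dots> \<le> card EL + card ER + (card (cut x1) + card (cut x2))"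
      by (intro order_trans[OF card_Un_le] add_mono card_Un_le)
    finally have "real (card E) \<le> real (card EL) + real (card ER) + (real (card (cut x1)) + real (card (cut x2)))"
      by linarith
    also have "\<dots> \<le> 6 * ?K * real (card VL) * log 2 (real (card VL))
        + 6 * ?K * real (card VR) * log 2 (real (card VR)) + (3 * ?K * real ?n + 3 * ?K * real ?n)"
      by (intro add_mono L R cut)
    also have "\<dots> = 6 * ?K * (real (card VL) * log 2 (real (card VL)) + real (card VR) * log 2 (real (card VR)) + real ?n)"
      by (simp only: distrib_left ac_simps)
    also have "\<dots> \<le> 6 * ?K * (real ?n * log 2 (real ?n))"
    proof (rule mult_left_mono)
      \<comment> \<open>Two vertices suffice to make \<open>log 2 (real ?n) - 1\<close> nonnegative,
        so that the sum of the two halves may be replaced by \<open>?n\<close>.\<close>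
      have "1 \<le> log 2 (real ?n)" using False by (simp add: le_log_iff)
      then have "(real (card VL) + real (card VR)) * (log 2 (real ?n) - 1) \<le> real ?n * (log 2 (real ?n) - 1)"
        using sum by (intro mult_right_mono) auto
      then show "real (card VL) * log 2 (real (card VL)) + real (card VR) * log 2 (real (card VR)) + real ?n
          \<le> real ?n * log 2 (real ?n)"
        using half_mult_log_le[OF half(1)] half_mult_log_le[OF half(2)] by (simp add: algebra_simps)
    qed simp
    finally show ?thesis by (simp add: mult.assoc)
  qed
qed

section \<open>Numerical form of the bound\<close>

lemma star_const_le: "star_const k \<le> 2 ^ (3 * k\<^sup>2)"
proof -
  have "k \<le> k\<^sup>2" by (simp add: power2_eq_square)
  also have "\<dots> \<le> 2 ^ k\<^sup>2" by (simp add: less_imp_le_nat)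
  finally have "k - 1 \<le> 2 ^ k\<^sup>2" by simp
  moreover have "(3::nat) ^ ((k - 1)\<^sup>2) \<le> 2 ^ (2 * k\<^sup>2)"
  proof -
    have "(3::nat) ^ ((k - 1)\<^sup>2) \<le> 4 ^ ((k - 1)\<^sup>2)" by (rule power_mono) auto
    also have "\<dots> \<le> 4 ^ (k\<^sup>2)" by (intro power_increasing power_mono) auto
    finally show ?thesis by (simp add: power_mult)
  qed
  ultimately have "star_const k \<le> 2 ^ k\<^sup>2 * 2 ^ (2 * k\<^sup>2)"
    unfolding star_const_def by (rule mult_le_mono)
  then show ?thesis by (simp flip: power_add)
qed

theorem theorem2:
  shows "\<exists>c::real. \<forall>k::nat. \<forall>V E g. k \<ge> 2 \<and> xmono_topological_graph V E g \<and> quasi_planar k E g \<longrightarrow>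
           real (card E) \<le> 2 powr (c * real k ^ 6) * real (card V) * log 2 (real (card V))"
proof (intro exI[of _ 11] allI impI, elim conjE)
  fix k :: nat and V E g
  assume k: "2 \<le> k" and G: "xmono_topological_graph V E g" "quasi_planar k E g"
  \<comment> \<open>The constant is 11 = 5 + 6: the numerical factor 24 is at most
    \<open>2^5\<close>, the square of \<open>2^(3 * k^2)\<close> is \<open>2^(6 * k^2)\<close>, and
    both 1 and \<open>k^2\<close> are at most \<open>k^6\<close>.\<close>
  have "6 * (2 * star_const k)\<^sup>2 \<le> 6 * (2 * 2 ^ (3 * k\<^sup>2))\<^sup>2"
    using star_const_le by (intro mult_left_mono power_mono) auto
  also have "\<dots> = 24 * 2 ^ (6 * k\<^sup>2)"
    by (simp add: power_mult_distrib flip: power_mult)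
  also have "\<dots> \<le> 2 ^ 5 * 2 ^ (6 * k\<^sup>2)" by simp
  also have "\<dots> = 2 ^ (5 + 6 * k\<^sup>2)" by (simp only: power_add)
  also have "\<dots> \<le> 2 ^ (11 * k ^ 6)"
  proof (rule power_increasing)
    have "1 \<le> k\<^sup>2" "k\<^sup>2 \<le> k ^ 6" using k by (auto intro: power_increasing)
    then show "5 + 6 * k\<^sup>2 \<le> 11 * k ^ 6" by linarith
  qed simp
  finally have "real (6 * (2 * star_const k)\<^sup>2) \<le> real (2 ^ (11 * k ^ 6))" by (rule of_nat_mono)
  also have "\<dots> = 2 powr (11 * real k ^ 6)" by (simp flip: powr_realpow)
  finally have C: "6 * real ((2 * star_const k)\<^sup>2) \<le> 2 powr (11 * real k ^ 6)" by simp
  have "0 \<le> real (card V) * log 2 (real (card V))"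
    by (cases "card V = 0") auto
  with C have "6 * real ((2 * star_const k)\<^sup>2) * (real (card V) * log 2 (real (card V)))
      \<le> 2 powr (11 * real k ^ 6) * (real (card V) * log 2 (real (card V)))"
    by (rule mult_right_mono)
  then show "real (card E) \<le> 2 powr (11 * real k ^ 6) * real (card V) * log 2 (real (card V))"
    using edges_card_le_n_log_n[OF k G] by (simp add: mult.assoc)
qed

end
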